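(* Let $\Phi:[0,1]\to\mathbb R$ be a twice continuously differentiable and strictly convex function, and let $\rho\in(0,1)$. Then there exists $\epsilon>0$ such that for every $n\ge1$ and every balanced Boolean function $f:\{\pm1\}^n\to\{0,1\}$ satisfying $0<\min_{i\in[n]}\tilde d_i(f)\le\epsilon$, $$\mathbf{Stab}_\Phi[f]<\mathbf{Stab}_\Phi[f_{\mathrm d}],$$ where $f_{\mathrm d}$ is a dictator function.
   Context: $[n]=\{1,\dots,n\}$. $\mu$ is the uniform measure on $\{\pm1\}^n$ and $\mathbf X\sim\mu$. $\mathbf Y$ is obtained from $\mathbf X$ by flipping each coordinate's sign independently with probability $\frac{1-\rho}{2}$; $T_\rho f(\mathbf x)=\mathbb E[f(\mathbf Y)\mid\mathbf X=\mathbf x]$. $\mathbf{Stab}_\Phi[f]:=\mathbb E[\Phi(T_\rho f(\mathbf X))]$. $f$ is balanced if $\mathbb E[f(\mathbf X)]=1/2$. A dictator function is $1\{x_k=1\}$ or $1\{x_k=-1\}$ for some $k$; its $\Phi$-stability is $\frac12\big(\Phi(\frac{1+\rho}2)+\Phi(\frac{1-\rho}2)\big)$. With $A=f^{-1}(1)$ and $C_i=\{\mathbf x:x_i=1\}$, $d_i(f):=\mu(A\Delta C_i)$ and $\tilde d_i(f):=\min\{d_i(f),1-d_i(f)\}$. *)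

theory Defs
  imports "HOL-Probability.Probability"
begin

(* Derivatives are taken within S, hence one-sided at the endpoints of a closed interval. *)
definition twice_cont_diff_on :: "real set \<Rightarrow> (real \<Rightarrow> real) \<Rightarrow> bool" where
  "twice_cont_diff_on S g \<longleftrightarrow>
     (\<exists>g' g''. (\<forall>x\<in>S. (g has_real_derivative g' x) (at x within S)) \<and>
               (\<forall>x\<in>S. (g' has_real_derivative g'' x) (at x within S)) \<and>
               continuous_on S g'')"

definition strictly_convex_on :: "real set \<Rightarrow> (real \<Rightarrow> real) \<Rightarrow> bool" where
  "strictly_convex_on S g \<longleftrightarrow> convex S \<and>
     (\<forall>x\<in>S. \<forall>y\<in>S. \<forall>t. x \<noteq> y \<and> 0 < t \<and> t < 1 \<longrightarrow>
        g ((1 - t) * x + t * y) < (1 - t) * g x + t * g y)"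

(* A point of {-1,1}^n is a function that is undefined outside {1..n}, so that
   points are equal iff their n coordinates agree. *)
definition cube :: "nat \<Rightarrow> (nat \<Rightarrow> int) set" where
  "cube n = {1..n} \<rightarrow>\<^sub>E {-1, 1}"

definition cube_unif :: "nat \<Rightarrow> (nat \<Rightarrow> int) pmf" where
  "cube_unif n = pmf_of_set (cube n)"

definition flip :: "nat \<Rightarrow> (nat \<Rightarrow> bool) \<Rightarrow> (nat \<Rightarrow> int) \<Rightarrow> (nat \<Rightarrow> int)" where
  "flip n b x = (\<lambda>i\<in>{1..n}. if b i then - x i else x i)"

definition flip_pattern :: "real \<Rightarrow> nat \<Rightarrow> (nat \<Rightarrow> bool) pmf" where
  "flip_pattern \<rho> n = Pi_pmf {1..n} False (\<lambda>_. bernoulli_pmf ((1 - \<rho>) / 2))"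

(* The joint law of (X, Y). *)
definition noisy_pair :: "real \<Rightarrow> nat \<Rightarrow> ((nat \<Rightarrow> int) \<times> (nat \<Rightarrow> int)) pmf" where
  "noisy_pair \<rho> n =
     map_pmf (\<lambda>(x, b). (x, flip n b x)) (pair_pmf (cube_unif n) (flip_pattern \<rho> n))"

(* E[f(Y) | X = x], relevant for x in cube n only. *)
definition noise_op :: "real \<Rightarrow> nat \<Rightarrow> ((nat \<Rightarrow> int) \<Rightarrow> real) \<Rightarrow> (nat \<Rightarrow> int) \<Rightarrow> real" where
  "noise_op \<rho> n f x =
     measure_pmf.expectation (cond_pmf (noisy_pair \<rho> n) {p. fst p = x}) (\<lambda>p. f (snd p))"

definition Stab :: "(real \<Rightarrow> real) \<Rightarrow> real \<Rightarrow> nat \<Rightarrow> ((nat \<Rightarrow> int) \<Rightarrow> real) \<Rightarrow> real" where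
  "Stab \<Phi> \<rho> n f = measure_pmf.expectation (cube_unif n) (\<lambda>x. \<Phi> (noise_op \<rho> n f x))"

definition boolean_fun :: "nat \<Rightarrow> ((nat \<Rightarrow> int) \<Rightarrow> real) \<Rightarrow> bool" where
  "boolean_fun n f \<longleftrightarrow> f \<in> cube n \<rightarrow> {0, 1}"

definition balanced :: "nat \<Rightarrow> ((nat \<Rightarrow> int) \<Rightarrow> real) \<Rightarrow> bool" where
  "balanced n f \<longleftrightarrow> measure_pmf.expectation (cube_unif n) f = 1 / 2"

definition dictator :: "nat \<Rightarrow> ((nat \<Rightarrow> int) \<Rightarrow> real) \<Rightarrow> bool" where
  "dictator n f \<longleftrightarrow>
     (\<exists>k\<in>{1..n}. (\<forall>x\<in>cube n. f x = of_bool (x k = 1)) \<or>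
                 (\<forall>x\<in>cube n. f x = of_bool (x k = -1)))"

definition dict_dist :: "nat \<Rightarrow> ((nat \<Rightarrow> int) \<Rightarrow> real) \<Rightarrow> nat \<Rightarrow> real" where
  "dict_dist n f i =
     measure_pmf.prob (cube_unif n) (sym_diff {x \<in> cube n. f x = 1} {x \<in> cube n. x i = 1})"

definition dict_dist_sym :: "nat \<Rightarrow> ((nat \<Rightarrow> int) \<Rightarrow> real) \<Rightarrow> nat \<Rightarrow> real" where
  "dict_dist_sym n f i = min (dict_dist n f i) (1 - dict_dist n f i)"

lemma finite_cube [simp]: "finite (cube n)"
  by (simp add: cube_def finite_PiE)

lemma cube_nonempty [simp]: "cube n \<noteq> {}"
  by (simp add: cube_def PiE_eq_empty_iff)

lemma set_cube_unif [simp]: "set_pmf (cube_unif n) = cube n"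
  by (simp add: cube_unif_def)

lemma flip_in_cube: "x \<in> cube n \<Longrightarrow> flip n b x \<in> cube n"
  by (fastforce simp: cube_def flip_def PiE_iff)

lemma cond_noisy_pair:
  assumes x: "x \<in> cube n"
  shows "cond_pmf (noisy_pair \<rho> n) {p. fst p = x} =
         map_pmf (\<lambda>b. (x, flip n b x)) (flip_pattern \<rho> n)"
proof -
  let ?P = "pair_pmf (cube_unif n) (flip_pattern \<rho> n)"
  let ?S = "{p :: (nat \<Rightarrow> int) \<times> (nat \<Rightarrow> bool). fst p = x}"
  have ne: "set_pmf ?P \<inter> ?S \<noteq> {}"
    using x set_pmf_not_empty[of "flip_pattern \<rho> n"] by auto
  have "measure_pmf.prob ?P ?S = measure_pmf.prob (map_pmf fst ?P) {x}"
    by (simp add: vimage_def del: map_fst_pair_pmf)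
  then have S: "measure_pmf.prob ?P ?S = pmf (cube_unif n) x"
    by (simp add: map_fst_pair_pmf pmf.rep_eq)
  have pos: "pmf (cube_unif n) x \<noteq> 0"
    using x by (simp add: cube_unif_def)
  have c: "cond_pmf ?P ?S = map_pmf (Pair x) (flip_pattern \<rho> n)"
  proof (rule pmf_eqI)
    fix p :: "(nat \<Rightarrow> int) \<times> (nat \<Rightarrow> bool)"
    obtain y b where p: "p = (y, b)" by fastforce
    have "inj (Pair x :: (nat \<Rightarrow> bool) \<Rightarrow> _)" by (simp add: inj_on_def)
    then have "pmf (map_pmf (Pair x) (flip_pattern \<rho> n)) (x, b) = pmf (flip_pattern \<rho> n) b"
      by (rule pmf_map_inj')
    moreover have "pmf (map_pmf (Pair x) (flip_pattern \<rho> n)) (y, b) = 0" if "y \<noteq> x"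
      using that by (auto simp: pmf_eq_0_set_pmf)
    ultimately show "pmf (cond_pmf ?P ?S) p = pmf (map_pmf (Pair x) (flip_pattern \<rho> n)) p"
      using pos by (auto simp: pmf_cond[OF ne] p S pmf_pair)
  qed
  let ?g = "\<lambda>(y, b). (y, flip n b y)"
  have v: "?g -` {p. fst p = x} = ?S" by auto
  have "cond_pmf (noisy_pair \<rho> n) {p. fst p = x} = map_pmf ?g (cond_pmf ?P ?S)"
    unfolding noisy_pair_def using ne by (subst cond_map_pmf) (simp_all only: v not_False_eq_True)
  then show ?thesis
    by (simp add: c pmf.map_comp o_def)
qed

lemma noise_op_eq:
  assumes "x \<in> cube n"
  shows "noise_op \<rho> n f x =
         measure_pmf.expectation (flip_pattern \<rho> n) (\<lambda>b. f (flip n b x))"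
  by (simp add: noise_op_def cond_noisy_pair[OF assms])

end

theory Submission
  imports Defs
begin

text \<open>
  Let \<open>g = (1 + s x\<^sub>k) / 2\<close>, \<open>s = \<plusminus>1\<close>, be the dictator closest to \<open>f\<close>, and write \<open>f = g + h\<close>.
  Then \<open>h\<close> takes values in \<open>{-1, 0, 1}\<close>, has mean \<open>0\<close>, and \<open>\<delta> = E[h\<^sup>2]\<close> is the distance
  from \<open>f\<close> to \<open>g\<close>. Write \<open>T\<close> for the noise operator. A second-order bound on \<open>\<Phi>\<close> gives
  \<open>Stab f - Stab g \<le> E[\<Phi>'(T g) T h] + M E[(T h)\<^sup>2]\<close>, and the two terms on the right have
  different orders in \<open>\<delta>\<close>.

  The first-order term is exactly linear in \<open>\<delta>\<close> and negative (lemma \<open>first_order_loss\<close>).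
  Since \<open>T g\<close> depends on the coordinate \<open>x\<^sub>k\<close> alone, \<open>\<Phi>'(T g) = a + b s x\<^sub>k\<close> with \<open>b > 0\<close> by
  strict convexity. The operator \<open>T\<close> is self-adjoint and multiplies \<open>x\<^sub>k\<close> by \<open>\<rho>\<close>, so the
  term equals \<open>a E[h] + \<rho> b E[h s x\<^sub>k] = - \<rho> b \<delta>\<close>: an error \<open>h\<close> always points away
  from the value of \<open>g\<close>, so \<open>h s x\<^sub>k = - h\<^sup>2\<close>.

  The second-order term is \<open>o(\<delta>)\<close> uniformly in \<open>n\<close>, because noise shrinks functions of
  small support (lemma \<open>small_set_expansion\<close>). For noise parameters \<open>\<sigma>\<close> with \<open>\<sigma>\<^sup>2 \<le> 1/3\<close>
  this follows from the elementary hypercontractive inequality between the 2-norm and the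
  4-norm (lemma \<open>hypercontractive_2_4\<close>) by duality. Parameters closer to \<open>1\<close> are reduced to
  that case by \<open>E[(T\<^sub>\<sigma> h)\<^sup>2] = E[h T\<^sub>\<sigma>\<^sub>\<sigma> h]\<close> and Cauchy-Schwarz, which bound the noise-stability
  at \<open>\<sigma>\<close> by that at \<open>\<sigma>\<^sup>2\<close>; repeated squaring brings the parameter below the threshold in a
  number of steps that depends on \<open>\<rho>\<close> only. Hence for small \<open>\<delta> > 0\<close> the loss dominates.
\<close>

section \<open>The noise operator as an integral kernel on the cube\<close>

definition cube_mean :: "nat \<Rightarrow> ((nat \<Rightarrow> int) \<Rightarrow> real) \<Rightarrow> real" where
  "cube_mean n f = (\<Sum>x\<in>cube n. f x) / 2 ^ n"

definition noise_kernel :: "real \<Rightarrow> nat \<Rightarrow> (nat \<Rightarrow> int) \<Rightarrow> (nat \<Rightarrow> int) \<Rightarrow> real" where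
  "noise_kernel \<rho> n x y = (\<Prod>i\<in>{1..n}. (1 + \<rho> * of_int (x i * y i)) / 2)"

text \<open>
  This is the noise operator in a form that makes sense for every real parameter and every
  point; composition, self-adjointness and the value at parameter \<open>0\<close> are then identities
  about sums of products.
\<close>

definition smooth :: "real \<Rightarrow> nat \<Rightarrow> ((nat \<Rightarrow> int) \<Rightarrow> real) \<Rightarrow> (nat \<Rightarrow> int) \<Rightarrow> real" where
  "smooth \<rho> n f x = (\<Sum>y\<in>cube n. noise_kernel \<rho> n x y * f y)"

lemma cube_coord: "x \<in> cube n \<Longrightarrow> i \<in> {1..n} \<Longrightarrow> x i = 1 \<or> x i = -1"
  by (auto simp: cube_def PiE_iff)

lemma boolean_fun_cases: "boolean_fun n f \<Longrightarrow> x \<in> cube n \<Longrightarrow> f x = 0 \<or> f x = 1"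
  by (auto simp: boolean_fun_def)

lemma cube_eqI: "x \<in> cube n \<Longrightarrow> y \<in> cube n \<Longrightarrow> (\<And>i. i \<in> {1..n} \<Longrightarrow> x i = y i) \<Longrightarrow> x = y"
  unfolding cube_def by (rule PiE_ext)

lemma cube_unif_expectation: "measure_pmf.expectation (cube_unif n) f = cube_mean n f"
proof -
  have "card (cube n) = 2 ^ n"
    by (simp add: cube_def card_funcsetE numeral_2_eq_2)
  then show ?thesis
    by (simp add: cube_unif_def cube_mean_def integral_pmf_of_set)
qed

lemma cube_mean_add: "cube_mean n (\<lambda>x. f x + g x) = cube_mean n f + cube_mean n g"
  and cube_mean_diff: "cube_mean n (\<lambda>x. f x - g x) = cube_mean n f - cube_mean n g"
  and cube_mean_cmult: "cube_mean n (\<lambda>x. c * f x) = c * cube_mean n f"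
  by (simp_all add: cube_mean_def sum.distrib sum_subtractf sum_distrib_left
      add_divide_distrib diff_divide_distrib)

lemma cube_mean_cong: "(\<And>x. x \<in> cube n \<Longrightarrow> f x = g x) \<Longrightarrow> cube_mean n f = cube_mean n g"
  by (simp add: cube_mean_def)

lemma cube_mean_mono: "(\<And>x. x \<in> cube n \<Longrightarrow> f x \<le> g x) \<Longrightarrow> cube_mean n f \<le> cube_mean n g"
  by (simp add: cube_mean_def sum_mono divide_right_mono)

lemma cube_mean_nonneg: "(\<And>x. x \<in> cube n \<Longrightarrow> 0 \<le> f x) \<Longrightarrow> 0 \<le> cube_mean n f"
  by (simp add: cube_mean_def sum_nonneg)

lemma cube_mean_Cauchy_Schwarz:
  "(cube_mean n (\<lambda>x. f x * g x))\<^sup>2 \<le> cube_mean n (\<lambda>x. (f x)\<^sup>2) * cube_mean n (\<lambda>x. (g x)\<^sup>2)"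
  using Cauchy_Schwarz_ineq_sum[of f g "cube n"]
  by (simp add: cube_mean_def power_divide divide_simps power2_eq_square)

lemma noise_kernel_commute: "noise_kernel \<rho> n x y = noise_kernel \<rho> n y x"
  by (simp add: noise_kernel_def mult.commute)

text \<open>All explicit evaluations of the kernel below rest on this independence of coordinates.\<close>

lemma sum_cube_prod:
  fixes F :: "nat \<Rightarrow> int \<Rightarrow> real"
  shows "(\<Sum>y\<in>cube n. \<Prod>i\<in>{1..n}. F i (y i)) = (\<Prod>i\<in>{1..n}. F i 1 + F i (-1))"
  using prod_sum_PiE[of "{1..n}" "\<lambda>_. {1, -1 :: int}" F]
  by (simp add: cube_def insert_commute)

lemma noise_kernel_compose:
  "(\<Sum>y\<in>cube n. noise_kernel \<rho> n x y * noise_kernel \<sigma> n y z) = noise_kernel (\<rho> * \<sigma>) n x z"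
proof -
  have "(\<Sum>y\<in>cube n. noise_kernel \<rho> n x y * noise_kernel \<sigma> n y z) =
    (\<Sum>y\<in>cube n. \<Prod>i\<in>{1..n}.
      (1 + \<rho> * of_int (x i * y i)) / 2 * ((1 + \<sigma> * of_int (y i * z i)) / 2))"
    by (simp only: noise_kernel_def prod.distrib)
  also have "\<dots> = noise_kernel (\<rho> * \<sigma>) n x z"
    unfolding noise_kernel_def sum_cube_prod[where F = "\<lambda>i v.
      (1 + \<rho> * of_int (x i * v)) / 2 * ((1 + \<sigma> * of_int (v * z i)) / 2)"]
    by (intro prod.cong) (auto simp: field_simps)
  finally show ?thesis .
qed

lemma smooth_smooth: "smooth \<rho> n (smooth \<sigma> n f) x = smooth (\<rho> * \<sigma>) n f x"
proof -
  have "smooth \<rho> n (smooth \<sigma> n f) x =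
      (\<Sum>y\<in>cube n. \<Sum>z\<in>cube n. noise_kernel \<rho> n x y * noise_kernel \<sigma> n y z * f z)"
    by (simp add: smooth_def sum_distrib_left mult.assoc)
  also have "\<dots> = (\<Sum>z\<in>cube n. \<Sum>y\<in>cube n. noise_kernel \<rho> n x y * noise_kernel \<sigma> n y z * f z)"
    by (rule sum.swap)
  also have "\<dots> = smooth (\<rho> * \<sigma>) n f x"
    by (simp add: smooth_def noise_kernel_compose flip: sum_distrib_right)
  finally show ?thesis .
qed

lemma smooth_selfadjoint:
  "cube_mean n (\<lambda>x. smooth \<rho> n f x * g x) = cube_mean n (\<lambda>x. f x * smooth \<rho> n g x)"
proof -
  have "(\<Sum>x\<in>cube n. smooth \<rho> n f x * g x) =
      (\<Sum>x\<in>cube n. \<Sum>y\<in>cube n. noise_kernel \<rho> n x y * f y * g x)"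
    by (simp add: smooth_def sum_distrib_right)
  also have "\<dots> = (\<Sum>y\<in>cube n. \<Sum>x\<in>cube n. noise_kernel \<rho> n x y * f y * g x)"
    by (rule sum.swap)
  also have "\<dots> = (\<Sum>y\<in>cube n. f y * smooth \<rho> n g y)"
    by (intro sum.cong refl)
      (simp add: smooth_def sum_distrib_left noise_kernel_commute mult_ac)
  finally show ?thesis by (simp add: cube_mean_def)
qed

lemma smooth_one: "smooth \<rho> n (\<lambda>_. 1) x = 1"
  using sum_cube_prod[of "\<lambda>i v. (1 + \<rho> * of_int (x i * v)) / 2" n]
  by (simp add: smooth_def noise_kernel_def add_divide_distrib diff_divide_distrib)

lemma smooth_coord:
  assumes "k \<in> {1..n}"
  shows "smooth \<rho> n (\<lambda>x. of_int (x k)) x = \<rho> * of_int (x k)"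
proof -
  have "smooth \<rho> n (\<lambda>x. of_int (x k)) x =
      (\<Sum>y\<in>cube n. \<Prod>i\<in>{1..n}. (1 + \<rho> * of_int (x i * y i)) / 2 * (if i = k then of_int (y i) else 1))"
    unfolding smooth_def noise_kernel_def prod.distrib
    by (intro sum.cong refl arg_cong2[where f = "(*)"]) (use assms in \<open>simp add: prod.delta\<close>)
  also have "\<dots> = (\<Prod>i\<in>{1..n}. if i = k then \<rho> * of_int (x i) else 1)"
    unfolding sum_cube_prod[where F = "\<lambda>i v.
      (1 + \<rho> * of_int (x i * v)) / 2 * (if i = k then of_int v else 1)"]
    by (intro prod.cong) (auto simp: field_simps)
  also have "\<dots> = \<rho> * of_int (x k)"
    using assms by (simp add: prod.delta)
  finally show ?thesis .
qed

lemma smooth_add: "smooth \<rho> n (\<lambda>x. f x + g x) x = smooth \<rho> n f x + smooth \<rho> n g x"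
  and smooth_diff: "smooth \<rho> n (\<lambda>x. f x - g x) x = smooth \<rho> n f x - smooth \<rho> n g x"
  and smooth_cmult: "smooth \<rho> n (\<lambda>x. c * f x) x = c * smooth \<rho> n f x"
  by (simp_all add: smooth_def sum.distrib sum_subtractf sum_distrib_left algebra_simps)

lemma smooth_affine_coord:
  assumes "k \<in> {1..n}"
  shows "smooth \<rho> n (\<lambda>x. a + b * of_int (x k)) x = a + b * \<rho> * of_int (x k)"
  using smooth_add[of \<rho> n "\<lambda>_. a * 1" "\<lambda>x. b * of_int (x k)" x]
  by (simp only: smooth_cmult smooth_coord[OF assms] smooth_one) simp

text \<open>
  At parameter \<open>0\<close> the kernel is constant, so means can be computed with the evaluations of the
  noise operator.
\<close>

lemma cube_mean_eq_smooth_zero: "cube_mean n f = smooth 0 n f x" for x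
  by (simp add: smooth_def cube_mean_def noise_kernel_def sum_distrib_left sum_divide_distrib
      power_divide)

lemma cube_mean_affine_coord:
  assumes "k \<in> {1..n}"
  shows "cube_mean n (\<lambda>x. a + b * of_int (x k)) = a"
  using smooth_affine_coord[OF assms, of 0 a b "\<lambda>_. 0"]
  by (simp add: cube_mean_eq_smooth_zero[of n _ "\<lambda>_. 0"])

lemma smooth_mono:
  assumes "x \<in> cube n" "\<bar>\<rho>\<bar> \<le> 1" "\<And>y. y \<in> cube n \<Longrightarrow> f y \<le> g y"
  shows "smooth \<rho> n f x \<le> smooth \<rho> n g x"
proof -
  have "0 \<le> noise_kernel \<rho> n x y" if "y \<in> cube n" for y
    unfolding noise_kernel_def
  proof (rule prod_nonneg)
    fix i assume "i \<in> {1..n}"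
    then have "x i = 1 \<or> x i = -1" "y i = 1 \<or> y i = -1"
      using assms(1) that by (simp_all add: cube_coord)
    then show "0 \<le> (1 + \<rho> * real_of_int (x i * y i)) / 2"
      using assms(2) by auto
  qed
  then show ?thesis
    unfolding smooth_def by (intro sum_mono mult_left_mono assms(3))
qed

lemma smooth_unit_interval:
  assumes "x \<in> cube n" "\<bar>\<rho>\<bar> \<le> 1" "\<And>y. y \<in> cube n \<Longrightarrow> f y \<in> {0..1}"
  shows "smooth \<rho> n f x \<in> {0..1}"
proof -
  have "smooth \<rho> n (\<lambda>_. 0 * 1) x \<le> smooth \<rho> n f x" "smooth \<rho> n f x \<le> smooth \<rho> n (\<lambda>_. 1) x"
    using assms(3) by (intro smooth_mono[OF assms(1,2)]; force)+
  then show ?thesis by (simp only: smooth_cmult smooth_one) simp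
qed

text \<open>
  For a fixed \<open>x\<close> in the cube, a flip pattern is determined by the point that it produces, and its
  probability is the kernel: coordinate \<open>i\<close> contributes \<open>(1 - \<rho>) / 2\<close> if it is flipped,
  that is, if \<open>x\<^sub>i y\<^sub>i = -1\<close>, and \<open>(1 + \<rho>) / 2\<close> otherwise.
\<close>

lemma noise_op_eq_smooth:
  assumes x: "x \<in> cube n" and \<rho>: "\<bar>\<rho>\<bar> \<le> 1"
  shows "noise_op \<rho> n f x = smooth \<rho> n f x"
proof -
  let ?B = "{b. \<forall>i. i \<notin> {1..n} \<longrightarrow> \<not> b i}"
  have "?B = PiE_dflt {1..n} False (\<lambda>_. UNIV)"
    by (auto simp: PiE_dflt_def)
  then have fin: "finite ?B"
    by (simp only: finite_PiE_dflt finite_atLeastAtMost finite)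
  have "set_pmf (flip_pattern \<rho> n) \<subseteq> ?B"
    unfolding flip_pattern_def using set_Pi_pmf_subset[of "{1..n}" False] by auto
  then have "noise_op \<rho> n f x = (\<Sum>b\<in>?B. f (flip n b x) * pmf (flip_pattern \<rho> n) b)"
    unfolding noise_op_eq[OF x] by (intro integral_measure_pmf_real[OF fin]) auto
  also have "\<dots> = (\<Sum>y\<in>cube n. noise_kernel \<rho> n x y * f y)"
  proof (rule sum.reindex_bij_witness[where i = "\<lambda>y i. i \<in> {1..n} \<and> y i \<noteq> x i" and j = "\<lambda>b. flip n b x"])
    fix b assume b: "b \<in> ?B"
    show "(\<lambda>i. i \<in> {1..n} \<and> flip n b x i \<noteq> x i) = b"
    proof
      fix i show "(i \<in> {1..n} \<and> flip n b x i \<noteq> x i) = b i"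
        using b cube_coord[OF x, of i] by (auto simp: flip_def)
    qed
    show "flip n b x \<in> cube n"
      by (rule flip_in_cube[OF x])
    have "pmf (flip_pattern \<rho> n) b = (\<Prod>i\<in>{1..n}. pmf (bernoulli_pmf ((1 - \<rho>) / 2)) (b i))"
      unfolding flip_pattern_def using b by (intro pmf_Pi') auto
    also have "\<dots> = noise_kernel \<rho> n x (flip n b x)"
      unfolding noise_kernel_def
    proof (rule prod.cong[OF refl])
      fix i assume i: "i \<in> {1..n}"
      show "pmf (bernoulli_pmf ((1 - \<rho>) / 2)) (b i) = (1 + \<rho> * of_int (x i * flip n b x i)) / 2"
        using cube_coord[OF x i] i \<rho> by (cases "b i") (auto simp: flip_def field_simps)
    qed
    finally show "noise_kernel \<rho> n x (flip n b x) * f (flip n b x) =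
        f (flip n b x) * pmf (flip_pattern \<rho> n) b"
      by simp
  next
    fix y assume y: "y \<in> cube n"
    show "flip n (\<lambda>i. i \<in> {1..n} \<and> y i \<noteq> x i) x = y"
    proof (rule cube_eqI[OF flip_in_cube[OF x] y])
      fix i assume i: "i \<in> {1..n}"
      show "flip n (\<lambda>i. i \<in> {1..n} \<and> y i \<noteq> x i) x i = y i"
        using cube_coord[OF x i] cube_coord[OF y i] i by (auto simp: flip_def)
    qed
  qed auto
  finally show ?thesis by (simp add: smooth_def)
qed

lemma Stab_eq_mean:
  assumes "\<bar>\<rho>\<bar> \<le> 1"
  shows "Stab \<Phi> \<rho> n f = cube_mean n (\<lambda>x. \<Phi> (smooth \<rho> n f x))"
  unfolding Stab_def cube_unif_expectation
  by (intro cube_mean_cong) (simp add: noise_op_eq_smooth assms)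

section \<open>Hypercontractivity and small-set expansion\<close>

lemma sum_cube_Suc:
  fixes f :: "(nat \<Rightarrow> int) \<Rightarrow> real"
  shows "(\<Sum>x\<in>cube (Suc n). f x) = (\<Sum>x\<in>cube n. f (x(Suc n := 1)) + f (x(Suc n := -1)))"
proof -
  have "cube (Suc n) = (\<lambda>(v, x). x(Suc n := v)) ` ({-1, 1} \<times> cube n)"
    using PiE_insert_eq[of "Suc n" "{1..n}" "\<lambda>_. {-1, 1 :: int}"]
    by (simp add: cube_def atLeastAtMostSuc_conv)
  moreover have "inj_on (\<lambda>(v, x). x(Suc n := v)) ({-1, 1 :: int} \<times> cube n)"
    unfolding cube_def by (rule inj_combinator) simp
  ultimately have "(\<Sum>x\<in>cube (Suc n). f x) = (\<Sum>(v, x)\<in>{-1, 1} \<times> cube n. f (x(Suc n := v)))"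
    by (simp add: sum.reindex case_prod_unfold)
  also have "\<dots> = (\<Sum>v\<in>{-1, 1}. \<Sum>x\<in>cube n. f (x(Suc n := v)))"
    by (rule sum.cartesian_product[symmetric])
  finally show ?thesis by (simp add: sum.distrib)
qed

lemma cube_mean_Suc:
  "cube_mean (Suc n) f = cube_mean n (\<lambda>x. (f (x(Suc n := 1)) + f (x(Suc n := -1))) / 2)"
  by (simp add: cube_mean_def sum_cube_Suc field_simps flip: sum_divide_distrib)

lemma noise_kernel_Suc:
  "noise_kernel \<rho> (Suc n) (x(Suc n := v)) (y(Suc n := w)) =
     noise_kernel \<rho> n x y * ((1 + \<rho> * of_int (v * w)) / 2)"
proof -
  have "(\<Prod>i\<in>{1..n}. (1 + \<rho> * of_int ((x(Suc n := v)) i * (y(Suc n := w)) i)) / 2) = noise_kernel \<rho> n x y"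
    unfolding noise_kernel_def by (intro prod.cong) auto
  then show ?thesis
    by (simp add: noise_kernel_def)
qed

text \<open>
  Splitting \<open>f = a + x\<^sub>n\<^sub>+\<^sub>1 b\<close> along the last coordinate gives \<open>T f = T a + \<rho> x\<^sub>n\<^sub>+\<^sub>1 T b\<close>, the
  recursion that drives the induction on the dimension.
\<close>

lemma smooth_Suc:
  "smooth \<rho> (Suc n) f (x(Suc n := v)) =
     smooth \<rho> n (\<lambda>y. (f (y(Suc n := 1)) + f (y(Suc n := -1))) / 2) x +
     \<rho> * of_int v * smooth \<rho> n (\<lambda>y. (f (y(Suc n := 1)) - f (y(Suc n := -1))) / 2) x"
  unfolding smooth_def sum_cube_Suc noise_kernel_Suc sum_distrib_left sum.distrib[symmetric]
  by (intro sum.cong) (auto simp: field_simps)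

text \<open>
  Averaging \<open>(A + \<sigma> x\<^sub>n\<^sub>+\<^sub>1 B)\<^sup>4\<close> over the last coordinate kills the odd powers and leaves
  \<open>A\<^sup>4 + 6 \<sigma>\<^sup>2 A\<^sup>2 B\<^sup>2 + \<sigma>\<^sup>4 B\<^sup>4\<close>. The threshold \<open>1/3\<close> makes \<open>6 \<sigma>\<^sup>2 \<le> 2\<close>, so that with
  Cauchy-Schwarz on the cross term the induction hypotheses for \<open>a\<close> and \<open>b\<close> add up to the square
  of \<open>E[a\<^sup>2] + E[b\<^sup>2] = E[f\<^sup>2]\<close>.
\<close>

lemma hypercontractive_2_4:
  assumes "\<sigma>\<^sup>2 \<le> 1 / 3"
  shows "cube_mean n (\<lambda>x. (smooth \<sigma> n f x) ^ 4) \<le> (cube_mean n (\<lambda>x. (f x)\<^sup>2))\<^sup>2"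
proof (induction n arbitrary: f)
  case 0
  have "cube 0 = {\<lambda>_. undefined}" by (simp add: cube_def)
  then show ?case
    by (simp add: cube_mean_def smooth_def noise_kernel_def)
next
  case (Suc n)
  define a where "a = (\<lambda>y. (f (y(Suc n := 1)) + f (y(Suc n := -1))) / 2)"
  define b where "b = (\<lambda>y. (f (y(Suc n := 1)) - f (y(Suc n := -1))) / 2)"
  define A where "A = smooth \<sigma> n a"
  define B where "B = smooth \<sigma> n b"
  let ?a = "cube_mean n (\<lambda>x. (a x)\<^sup>2)" and ?b = "cube_mean n (\<lambda>x. (b x)\<^sup>2)"
  have nn: "0 \<le> ?a" "0 \<le> ?b"
    by (simp_all add: cube_mean_nonneg)
  have IH: "cube_mean n (\<lambda>x. A x ^ 4) \<le> ?a\<^sup>2" "cube_mean n (\<lambda>x. B x ^ 4) \<le> ?b\<^sup>2"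
    unfolding A_def B_def by (rule Suc.IH)+
  have "(cube_mean n (\<lambda>x. (A x)\<^sup>2 * (B x)\<^sup>2))\<^sup>2 \<le>
      cube_mean n (\<lambda>x. ((A x)\<^sup>2)\<^sup>2) * cube_mean n (\<lambda>x. ((B x)\<^sup>2)\<^sup>2)"
    by (rule cube_mean_Cauchy_Schwarz)
  also have "\<dots> \<le> ?a\<^sup>2 * ?b\<^sup>2"
    using IH by (intro mult_mono) (simp_all add: cube_mean_nonneg)
  finally have cross: "cube_mean n (\<lambda>x. (A x)\<^sup>2 * (B x)\<^sup>2) \<le> ?a * ?b"
    using nn by (simp add: power_mult_distrib[symmetric] power2_le_iff_abs_le)
  have s4: "\<sigma> ^ 4 \<le> 1"
    using power_mono[OF assms, of 2] by (simp add: power_divide flip: power_mult)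
  have "cube_mean (Suc n) (\<lambda>x. (smooth \<sigma> (Suc n) f x) ^ 4) =
      cube_mean n (\<lambda>x. A x ^ 4 + 6 * \<sigma>\<^sup>2 * ((A x)\<^sup>2 * (B x)\<^sup>2) + \<sigma> ^ 4 * B x ^ 4)"
    unfolding cube_mean_Suc smooth_Suc a_def[symmetric] b_def[symmetric]
      A_def[symmetric] B_def[symmetric]
    by (intro cube_mean_cong) (simp add: eval_nat_numeral field_simps)
  also have "\<dots> = cube_mean n (\<lambda>x. A x ^ 4) + 6 * \<sigma>\<^sup>2 * cube_mean n (\<lambda>x. (A x)\<^sup>2 * (B x)\<^sup>2) +
      \<sigma> ^ 4 * cube_mean n (\<lambda>x. B x ^ 4)"
    by (simp only: cube_mean_add cube_mean_cmult)
  also have "\<dots> \<le> ?a\<^sup>2 + 2 * (?a * ?b) + 1 * ?b\<^sup>2"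
    using assms s4 IH cross by (intro add_mono mult_mono) (simp_all add: cube_mean_nonneg)
  also have "\<dots> = (?a + ?b)\<^sup>2"
    by (simp add: power2_sum)
  also have "?a + ?b = cube_mean (Suc n) (\<lambda>x. (f x)\<^sup>2)"
    unfolding cube_mean_Suc cube_mean_add[symmetric] a_def b_def
    by (intro cube_mean_cong) (simp add: field_simps power2_eq_square)
  finally show ?case .
qed

lemma smooth_norm_duality:
  "cube_mean n (\<lambda>x. (smooth \<sigma> n h x)\<^sup>2) = cube_mean n (\<lambda>x. h x * smooth (\<sigma>\<^sup>2) n h x)"
  using smooth_selfadjoint[of n \<sigma> h "smooth \<sigma> n h"]
  by (simp add: smooth_smooth power2_eq_square)

text \<open>
  The step of the squaring argument: it trades the parameter \<open>\<sigma>\<close> for \<open>\<sigma>\<^sup>2\<close> at the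
  cost of a square root.
\<close>

lemma smooth_norm_square_le:
  "(cube_mean n (\<lambda>x. (smooth \<sigma> n h x)\<^sup>2))\<^sup>2 \<le>
     cube_mean n (\<lambda>x. (h x)\<^sup>2) * cube_mean n (\<lambda>x. (smooth (\<sigma>\<^sup>2) n h x)\<^sup>2)"
  unfolding smooth_norm_duality[of n \<sigma>] by (rule cube_mean_Cauchy_Schwarz)

text \<open>
  With \<open>N = E[(T h)\<^sup>2] = E[h u]\<close> and \<open>u = T (T h)\<close>, two applications of Cauchy-Schwarz amount to
  Hoelder's inequality with exponents \<open>4/3\<close> and \<open>4\<close>. They give \<open>N\<^sup>4 \<le> \<delta>\<^sup>3 E[u\<^sup>4]\<close>, and
  hypercontractivity bounds \<open>E[u\<^sup>4]\<close> by \<open>N\<^sup>2\<close>.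
\<close>

lemma small_set_expansion_base:
  assumes \<sigma>: "\<sigma>\<^sup>2 \<le> 1 / 3" and h: "\<And>x. x \<in> cube n \<Longrightarrow> h x \<in> {-1, 0, 1}"
    and \<delta>: "\<delta> = cube_mean n (\<lambda>x. (h x)\<^sup>2)"
  shows "(cube_mean n (\<lambda>x. (smooth \<sigma> n h x)\<^sup>2))\<^sup>2 \<le> \<delta> ^ 3"
proof -
  define N where "N = cube_mean n (\<lambda>x. (smooth \<sigma> n h x)\<^sup>2)"
  define u where "u = smooth \<sigma> n (smooth \<sigma> n h)"
  have N0: "0 \<le> N" and \<delta>0: "0 \<le> \<delta>"
    by (simp_all add: N_def \<delta> cube_mean_nonneg)
  have "N = cube_mean n (\<lambda>x. h x * u x)"
    unfolding N_def u_def smooth_smooth smooth_norm_duality by (simp add: power2_eq_square)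
  \<comment> \<open>Since \<open>h = h\<^sup>3\<close>, a factor \<open>h\<^sup>2\<close> can be inserted, which keeps the
    smallness of the support available for the second Cauchy-Schwarz.\<close>
  also have "\<dots> = cube_mean n (\<lambda>x. h x * ((h x)\<^sup>2 * u x))"
    using h by (intro cube_mean_cong) fastforce
  finally have "N\<^sup>2 \<le> \<delta> * cube_mean n (\<lambda>x. ((h x)\<^sup>2 * u x)\<^sup>2)"
    using cube_mean_Cauchy_Schwarz[of n h "\<lambda>x. (h x)\<^sup>2 * u x"] by (simp add: \<delta>)
  also have "cube_mean n (\<lambda>x. ((h x)\<^sup>2 * u x)\<^sup>2) = cube_mean n (\<lambda>x. (h x)\<^sup>2 * (u x)\<^sup>2)"
    using h by (intro cube_mean_cong) fastforce
  finally have 1: "N\<^sup>2 \<le> \<delta> * cube_mean n (\<lambda>x. (h x)\<^sup>2 * (u x)\<^sup>2)" .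
  have "(cube_mean n (\<lambda>x. (h x)\<^sup>2 * (u x)\<^sup>2))\<^sup>2 \<le>
      cube_mean n (\<lambda>x. ((h x)\<^sup>2)\<^sup>2) * cube_mean n (\<lambda>x. ((u x)\<^sup>2)\<^sup>2)"
    by (rule cube_mean_Cauchy_Schwarz)
  also have "cube_mean n (\<lambda>x. ((h x)\<^sup>2)\<^sup>2) = \<delta>"
    unfolding \<delta> using h by (intro cube_mean_cong) fastforce
  also have "cube_mean n (\<lambda>x. ((u x)\<^sup>2)\<^sup>2) \<le> N\<^sup>2"
    using hypercontractive_2_4[OF \<sigma>, of n "smooth \<sigma> n h"] by (simp add: u_def N_def)
  finally have 2: "(cube_mean n (\<lambda>x. (h x)\<^sup>2 * (u x)\<^sup>2))\<^sup>2 \<le> \<delta> * N\<^sup>2"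
    using \<delta>0 by (simp add: mult_left_mono)
  have "(N\<^sup>2)\<^sup>2 \<le> (\<delta> * cube_mean n (\<lambda>x. (h x)\<^sup>2 * (u x)\<^sup>2))\<^sup>2"
    using 1 by (rule power_mono) simp
  also have "\<dots> \<le> \<delta>\<^sup>2 * (\<delta> * N\<^sup>2)"
    unfolding power_mult_distrib using 2 by (rule mult_left_mono) simp
  finally have "N\<^sup>2 * N\<^sup>2 \<le> \<delta> ^ 3 * N\<^sup>2"
    by (simp add: power2_eq_square power3_eq_cube mult_ac)
  then show ?thesis
    using \<delta>0 unfolding N_def[symmetric]
    by (cases "N = 0") (simp, rule mult_right_le_imp_le[of _ "N\<^sup>2"], simp_all)
qed

text \<open>
  In terms of the ratio \<open>r \<sigma> = E[(T\<^sub>\<sigma> h)\<^sup>2] / \<delta>\<close>, the base case reads \<open>(r \<sigma>)\<^sup>2 \<le> \<delta>\<close> and the squaring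
  step reads \<open>(r \<sigma>)\<^sup>2 \<le> r (\<sigma>\<^sup>2)\<close>, so the exponent doubles with each squaring.
\<close>

lemma small_set_expansion:
  assumes \<sigma>: "(\<sigma> ^ 2 ^ K)\<^sup>2 \<le> 1 / 3" and h: "\<And>x. x \<in> cube n \<Longrightarrow> h x \<in> {-1, 0, 1}"
    and \<delta>: "\<delta> = cube_mean n (\<lambda>x. (h x)\<^sup>2)" "0 < \<delta>"
  shows "(cube_mean n (\<lambda>x. (smooth \<sigma> n h x)\<^sup>2) / \<delta>) ^ 2 ^ Suc K \<le> \<delta>"
  using \<sigma>
proof (induction K arbitrary: \<sigma>)
  case 0
  then have "(cube_mean n (\<lambda>x. (smooth \<sigma> n h x)\<^sup>2))\<^sup>2 \<le> \<delta> ^ 3"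
    using h \<delta>(1) by (intro small_set_expansion_base) simp_all
  then show ?case
    using \<delta>(2) by (simp add: field_simps power2_eq_square power3_eq_cube)
next
  case (Suc K)
  let ?r = "\<lambda>\<sigma>. cube_mean n (\<lambda>x. (smooth \<sigma> n h x)\<^sup>2) / \<delta>"
  have "(?r \<sigma>)\<^sup>2 \<le> ?r (\<sigma>\<^sup>2)"
    using smooth_norm_square_le[of n \<sigma> h] \<delta>(2) unfolding \<delta>(1)[symmetric]
    by (simp add: field_simps power2_eq_square)
  then have "((?r \<sigma>)\<^sup>2) ^ 2 ^ Suc K \<le> (?r (\<sigma>\<^sup>2)) ^ 2 ^ Suc K"
    by (rule power_mono) simp
  also have "\<dots> \<le> \<delta>"
    using Suc.prems by (intro Suc.IH) (simp flip: power_mult)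
  finally show ?case
    by (simp flip: power_mult)
qed


section \<open>Analysis of the convex function\<close>

text \<open>
  A Taylor bound with constant \<open>M\<close> instead of the sharp \<open>M / 2\<close>, where \<open>M\<close> bounds the second
  derivative: this needs only the mean value inequality, applied once to the first derivative and
  once to the function minus its tangent at \<open>t\<close>.
\<close>

lemma quadratic_upper_bound:
  fixes \<Phi> :: "real \<Rightarrow> real"
  assumes "twice_cont_diff_on {0..1} \<Phi>"
  obtains \<phi> M where "0 < M"
    "\<And>x. x \<in> {0..1} \<Longrightarrow> (\<Phi> has_real_derivative \<phi> x) (at x within {0..1})"
    "\<And>t u. t \<in> {0..1} \<Longrightarrow> u \<in> {0..1} \<Longrightarrow> \<Phi> u \<le> \<Phi> t + \<phi> t * (u - t) + M * (u - t)\<^sup>2"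
proof -
  obtain \<phi> \<psi> where d1: "\<And>x. x \<in> {0..1} \<Longrightarrow> (\<Phi> has_real_derivative \<phi> x) (at x within {0..1})"
    and d2: "\<And>x. x \<in> {0..1} \<Longrightarrow> (\<phi> has_real_derivative \<psi> x) (at x within {0..1})"
    and cont: "continuous_on {0..1} \<psi>"
    using assms unfolding twice_cont_diff_on_def by blast
  have "bounded (\<psi> ` {0..1})"
    by (intro compact_imp_bounded compact_continuous_image cont) simp
  then obtain M where M: "0 < M" "\<And>x. x \<in> {0..1} \<Longrightarrow> \<bar>\<psi> x\<bar> \<le> M"
    by (auto simp: bounded_pos)
  have bound: "\<Phi> u \<le> \<Phi> t + \<phi> t * (u - t) + M * (u - t)\<^sup>2" if t: "t \<in> {0..1}" and u: "u \<in> {0..1}" for t u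
  proof -
    let ?I = "closed_segment t u"
    have I: "?I \<subseteq> {0..1}"
      using t u by (simp add: closed_segment_subset)
    have "norm ((\<Phi> u - \<phi> t * u) - (\<Phi> t - \<phi> t * t)) \<le> (M * \<bar>u - t\<bar>) * norm (u - t)"
    proof (rule field_differentiable_bound[where S = ?I and f' = "\<lambda>x. \<phi> x - \<phi> t"])
      fix x assume x: "x \<in> ?I"
      then show "((\<lambda>x. \<Phi> x - \<phi> t * x) has_field_derivative \<phi> x - \<phi> t) (at x within ?I)"
        using I by (auto intro!: derivative_eq_intros DERIV_subset[OF d1])
      have "norm (\<phi> x - \<phi> t) \<le> M * norm (x - t)"
        using x I t M(2)
        by (intro field_differentiable_bound[where S = "{0..1}" and f' = \<psi>] d2) auto
      also have "\<dots> \<le> M * \<bar>u - t\<bar>"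
        using x M(1) by (auto simp: closed_segment_eq_real_ivl split: if_splits)
      finally show "norm (\<phi> x - \<phi> t) \<le> M * \<bar>u - t\<bar>" .
    qed auto
    then have "(\<Phi> u - \<phi> t * u) - (\<Phi> t - \<phi> t * t) \<le> M * (u - t)\<^sup>2"
      by (simp add: power2_eq_square mult.assoc)
    then show ?thesis by (simp add: algebra_simps)
  qed
  show ?thesis by (rule that[OF M(1) d1 bound])
qed

text \<open>
  At the midpoint of \<open>a\<close> and \<open>b\<close>, the function lies strictly below the chord but not below the
  tangents at \<open>a\<close> and \<open>b\<close>. Averaging the two tangent inequalities compares the slopes.
\<close>

lemma strictly_convex_deriv_strict_mono:
  assumes conv: "strictly_convex_on {0..1} \<Phi>"
    and d: "\<And>x. x \<in> {0..1} \<Longrightarrow> (\<Phi> has_real_derivative \<phi> x) (at x within {0..1})"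
    and ab: "0 < a" "a < b" "b < 1"
  shows "\<phi> a < \<phi> b"
proof -
  have strict: "\<Phi> ((1 - t) * x + t * y) < (1 - t) * \<Phi> x + t * \<Phi> y"
    if "x \<in> {0..1}" "y \<in> {0..1}" "x \<noteq> y" "0 < t" "t < 1" for x y t
    using conv that unfolding strictly_convex_on_def by blast
  have "convex_on {0..1} \<Phi>"
  proof (rule convex_onI)
    fix t x y :: real
    assume "0 < t" "t < 1" "x \<in> {0..1}" "y \<in> {0..1}"
    then show "\<Phi> ((1 - t) *\<^sub>R x + t *\<^sub>R y) \<le> (1 - t) * \<Phi> x + t * \<Phi> y"
      using strict[of x y t] by (cases "x = y") (auto simp: algebra_simps)
  qed simp
  then have tangent: "\<Phi> x - \<Phi> c \<ge> \<phi> c * (x - c)" if "c \<in> {a, b}" "x \<in> {0..1}" for x c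
    using that ab by (intro convex_on_imp_above_tangent[where A = "{0..1}"] d) auto
  define m where "m = (a + b) / 2"
  have "\<Phi> m < (\<Phi> a + \<Phi> b) / 2"
    using strict[of a b "1/2"] ab by (simp add: m_def field_simps)
  moreover have "\<Phi> m - \<Phi> a \<ge> \<phi> a * (m - a)" "\<Phi> m - \<Phi> b \<ge> \<phi> b * (m - b)"
    using ab by (intro tangent; simp add: m_def)+
  moreover have "m - a = (b - a) / 2" "m - b = - ((b - a) / 2)"
    by (simp_all add: m_def field_simps)
  ultimately have "\<phi> a * ((b - a) / 2) < \<phi> b * ((b - a) / 2)"
    by simp
  then show ?thesis
    using ab by (simp add: mult_less_cancel_right)
qed

section \<open>Stability of dictators and of functions near them\<close>

text \<open>
  Functions of a single coordinate are affine in it, which makes means and smoothings of them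
  computable.
\<close>

lemma sign_affine:
  fixes F :: "real \<Rightarrow> real"
  assumes "v = 1 \<or> v = (-1 :: int)"
  shows "F (of_int v) = (F 1 + F (-1)) / 2 + (F 1 - F (-1)) / 2 * of_int v"
  using assms by (auto simp: field_simps)

lemma Stab_dictator:
  assumes \<rho>: "\<bar>\<rho>\<bar> \<le> 1" and "dictator n f"
  shows "Stab \<Phi> \<rho> n f = (\<Phi> ((1 + \<rho>) / 2) + \<Phi> ((1 - \<rho>) / 2)) / 2"
proof -
  obtain k s where k: "k \<in> {1..n}" and s: "s = 1 \<or> s = (-1 :: real)"
    and f: "\<And>x. x \<in> cube n \<Longrightarrow> f x = 1/2 + s/2 * of_int (x k)"
  proof -
    obtain k where k: "k \<in> {1..n}"
      and "(\<forall>x\<in>cube n. f x = of_bool (x k = 1)) \<or> (\<forall>x\<in>cube n. f x = of_bool (x k = -1))"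
      using assms(2) unfolding dictator_def by blast
    then show thesis
      using that[OF k, of 1] that[OF k, of "-1"] cube_coord[OF _ k] by fastforce
  qed
  let ?F = "\<lambda>v. \<Phi> (1/2 + s/2 * \<rho> * v)"
  have "smooth \<rho> n f x = 1/2 + s/2 * \<rho> * of_int (x k)" for x
    unfolding smooth_affine_coord[OF k, symmetric] by (simp add: smooth_def f)
  then have "Stab \<Phi> \<rho> n f = cube_mean n (\<lambda>x. ?F (of_int (x k)))"
    by (simp add: Stab_eq_mean[OF \<rho>])
  also have "\<dots> = cube_mean n (\<lambda>x. (?F 1 + ?F (-1)) / 2 + (?F 1 - ?F (-1)) / 2 * of_int (x k))"
    using cube_coord[OF _ k] by (intro cube_mean_cong sign_affine)
  also have "\<dots> = (?F 1 + ?F (-1)) / 2"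
    by (rule cube_mean_affine_coord[OF k])
  also have "\<dots> = (\<Phi> ((1 + \<rho>) / 2) + \<Phi> ((1 - \<rho>) / 2)) / 2"
    using s by (auto simp: add_divide_distrib diff_divide_distrib add.commute)
  finally show ?thesis .
qed

lemma dict_dist_eq_mean:
  assumes k: "k \<in> {1..n}" and f: "boolean_fun n f"
  shows "dict_dist n f k = cube_mean n (\<lambda>x. (f x - (1/2 + 1/2 * of_int (x k)))\<^sup>2)"
proof -
  have "dict_dist n f k = measure_pmf.expectation (cube_unif n)
      (indicator (sym_diff {x \<in> cube n. f x = 1} {x \<in> cube n. x k = 1}))"
    by (simp add: dict_dist_def)
  also have "\<dots> = cube_mean n (\<lambda>x. (f x - (1/2 + 1/2 * of_int (x k)))\<^sup>2)"
    unfolding cube_unif_expectation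
  proof (rule cube_mean_cong)
    fix x assume x: "x \<in> cube n"
    show "indicator (sym_diff {x \<in> cube n. f x = 1} {x \<in> cube n. x k = 1}) x =
        (f x - (1/2 + 1/2 * of_int (x k)))\<^sup>2"
      using boolean_fun_cases[OF f x] cube_coord[OF x k] x by (auto simp: power2_eq_square)
  qed
  finally show ?thesis .
qed

text \<open>
  The symmetrised distance is the smaller of the distances to the two dictators of coordinate \<open>k\<close>:
  on \<open>{0, 1}\<close>-valued functions, disagreeing with one means agreeing with the other.
\<close>

lemma dict_dist_sym_eq_mean:
  assumes k: "k \<in> {1..n}" and f: "boolean_fun n f"
  obtains s :: real where "s = 1 \<or> s = -1"
    "dict_dist_sym n f k = cube_mean n (\<lambda>x. (f x - (1/2 + s/2 * of_int (x k)))\<^sup>2)"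
proof (cases "dict_dist n f k \<le> 1 - dict_dist n f k")
  case True
  then show ?thesis
    using dict_dist_eq_mean[OF k f] that[of 1] by (simp add: dict_dist_sym_def)
next
  case False
  have "1 = cube_mean n (\<lambda>x. 1 + 0 * of_int (x k))"
    by (rule cube_mean_affine_coord[OF k, symmetric])
  then have "1 - dict_dist n f k =
      cube_mean n (\<lambda>x. (1 + 0 * of_int (x k)) - (f x - (1/2 + 1/2 * of_int (x k)))\<^sup>2)"
    by (simp only: cube_mean_diff dict_dist_eq_mean[OF k f])
  also have "\<dots> = cube_mean n (\<lambda>x. (f x - (1/2 + (-1)/2 * of_int (x k)))\<^sup>2)"
  proof (rule cube_mean_cong)
    fix x assume x: "x \<in> cube n"
    show "1 + 0 * of_int (x k) - (f x - (1/2 + 1/2 * of_int (x k)))\<^sup>2 =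
        (f x - (1/2 + (-1)/2 * of_int (x k)))\<^sup>2"
      using boolean_fun_cases[OF f x] cube_coord[OF x k] by (auto simp: power2_eq_square)
  qed
  finally show ?thesis
    using False that[of "-1"] by (simp add: dict_dist_sym_def)
qed

text \<open>
  The noise is moved from \<open>h\<close> to the derivative, which is affine in \<open>x\<^sub>k\<close>. Balancedness
  removes the constant part, and \<open>h s x\<^sub>k = - h\<^sup>2\<close> evaluates the other part.
\<close>

lemma first_order_loss:
  assumes k: "k \<in> {1..n}" and s: "s = 1 \<or> s = (-1 :: real)"
    and f: "boolean_fun n f" "balanced n f"
    and h: "h = (\<lambda>x. f x - (1/2 + s/2 * of_int (x k)))"
  shows "cube_mean n (\<lambda>x. \<phi> (1/2 + s/2 * \<rho> * of_int (x k)) * smooth \<rho> n h x) =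
    - \<rho> * ((\<phi> ((1 + \<rho>) / 2) - \<phi> ((1 - \<rho>) / 2)) / 2) * cube_mean n (\<lambda>x. (h x)\<^sup>2)"
proof -
  define a where "a = (\<phi> ((1 + \<rho>) / 2) + \<phi> ((1 - \<rho>) / 2)) / 2"
  define b where "b = (\<phi> ((1 + \<rho>) / 2) - \<phi> ((1 - \<rho>) / 2)) / 2"
  have "cube_mean n h = cube_mean n f - cube_mean n (\<lambda>x. 1/2 + s/2 * of_int (x k))"
    unfolding h by (rule cube_mean_diff)
  then have h0: "cube_mean n h = 0"
    using f(2) unfolding balanced_def cube_unif_expectation cube_mean_affine_coord[OF k] by simp
  have hs: "h x * (s * of_int (x k)) = - (h x)\<^sup>2" if "x \<in> cube n" for x
    using boolean_fun_cases[OF f(1) that] cube_coord[OF that k] s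
    by (auto simp: h power2_eq_square)
  have "cube_mean n (\<lambda>x. \<phi> (1/2 + s/2 * \<rho> * of_int (x k)) * smooth \<rho> n h x) =
      cube_mean n (\<lambda>x. smooth \<rho> n h x * (a + b * s * of_int (x k)))"
  proof (rule cube_mean_cong)
    fix x assume x: "x \<in> cube n"
    show "\<phi> (1/2 + s/2 * \<rho> * of_int (x k)) * smooth \<rho> n h x =
        smooth \<rho> n h x * (a + b * s * of_int (x k))"
      using cube_coord[OF x k] s
      by (auto simp: a_def b_def add_divide_distrib diff_divide_distrib algebra_simps)
  qed
  also have "\<dots> = cube_mean n (\<lambda>x. h x * (a + b * s * \<rho> * of_int (x k)))"
    by (simp only: smooth_selfadjoint smooth_affine_coord[OF k])
  also have "\<dots> = cube_mean n (\<lambda>x. a * h x + - \<rho> * b * (h x)\<^sup>2)"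
  proof (rule cube_mean_cong)
    fix x assume "x \<in> cube n"
    from hs[OF this] show "h x * (a + b * s * \<rho> * of_int (x k)) = a * h x + - \<rho> * b * (h x)\<^sup>2"
      by algebra
  qed
  also have "\<dots> = - \<rho> * b * cube_mean n (\<lambda>x. (h x)\<^sup>2)"
    by (simp only: cube_mean_add cube_mean_cmult h0 mult_zero_right add_0_left)
  finally show ?thesis by (simp add: b_def)
qed

lemma Stab_near_dictator_le:
  assumes k: "k \<in> {1..n}" and s: "s = 1 \<or> s = (-1 :: real)" and \<rho>: "\<bar>\<rho>\<bar> \<le> 1"
    and f: "boolean_fun n f" "balanced n f"
    and h: "h = (\<lambda>x. f x - (1/2 + s/2 * of_int (x k)))"
    and taylor: "\<And>t u. t \<in> {0..1} \<Longrightarrow> u \<in> {0..1} \<Longrightarrow>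
      \<Phi> u \<le> \<Phi> t + \<phi> t * (u - t) + M * (u - t)\<^sup>2"
  shows "Stab \<Phi> \<rho> n f \<le> (\<Phi> ((1 + \<rho>) / 2) + \<Phi> ((1 - \<rho>) / 2)) / 2
    - \<rho> * ((\<phi> ((1 + \<rho>) / 2) - \<phi> ((1 - \<rho>) / 2)) / 2) * cube_mean n (\<lambda>x. (h x)\<^sup>2)
    + M * cube_mean n (\<lambda>x. (smooth \<rho> n h x)\<^sup>2)"
proof -
  define g where "g = (\<lambda>x :: nat \<Rightarrow> int. 1/2 + s/2 * of_int (x k))"
  define t where "t = (\<lambda>x :: nat \<Rightarrow> int. 1/2 + s/2 * \<rho> * of_int (x k))"
  have Tg: "smooth \<rho> n g x = t x" for x
    unfolding g_def t_def by (rule smooth_affine_coord[OF k])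
  have Tf: "smooth \<rho> n f x - t x = smooth \<rho> n h x" for x
    unfolding h Tg[symmetric] g_def smooth_diff ..
  have g01: "g x \<in> {0..1}" if "x \<in> cube n" for x
    using cube_coord[OF that k] s by (auto simp: g_def)
  have dict: "dictator n g"
    unfolding dictator_def
  proof (intro bexI[OF _ k], cases "s = 1")
    case True
    then have "g x = of_bool (x k = 1)" if "x \<in> cube n" for x
      using cube_coord[OF that k] by (auto simp: g_def)
    then show "(\<forall>x\<in>cube n. g x = of_bool (x k = 1)) \<or> (\<forall>x\<in>cube n. g x = of_bool (x k = -1))" by blast
  next
    case False
    with s have "g x = of_bool (x k = -1)" if "x \<in> cube n" for x
      using cube_coord[OF that k] by (auto simp: g_def)
    then show "(\<forall>x\<in>cube n. g x = of_bool (x k = 1)) \<or> (\<forall>x\<in>cube n. g x = of_bool (x k = -1))" by blast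
  qed
  have "Stab \<Phi> \<rho> n f = cube_mean n (\<lambda>x. \<Phi> (smooth \<rho> n f x))"
    by (rule Stab_eq_mean[OF \<rho>])
  also have "\<dots> \<le> cube_mean n (\<lambda>x. \<Phi> (t x) + \<phi> (t x) * smooth \<rho> n h x + M * (smooth \<rho> n h x)\<^sup>2)"
  proof (rule cube_mean_mono)
    fix x assume x: "x \<in> cube n"
    have "smooth \<rho> n g x \<in> {0..1}"
      by (rule smooth_unit_interval[OF x \<rho> g01])
    moreover have "smooth \<rho> n f x \<in> {0..1}"
      using boolean_fun_cases[OF f(1)] by (intro smooth_unit_interval[OF x \<rho>]) fastforce
    ultimately show "\<Phi> (smooth \<rho> n f x) \<le> \<Phi> (t x) + \<phi> (t x) * smooth \<rho> n h x + M * (smooth \<rho> n h x)\<^sup>2"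
      using taylor[of "t x" "smooth \<rho> n f x"] unfolding Tg Tf by blast
  qed
  also have "\<dots> = Stab \<Phi> \<rho> n g + cube_mean n (\<lambda>x. \<phi> (t x) * smooth \<rho> n h x)
      + M * cube_mean n (\<lambda>x. (smooth \<rho> n h x)\<^sup>2)"
    by (simp only: cube_mean_add cube_mean_cmult Stab_eq_mean[OF \<rho>] Tg)
  finally show ?thesis
    unfolding Stab_dictator[OF \<rho> dict] t_def first_order_loss[OF k s f h] by simp
qed

theorem theorem4p5:
  fixes \<Phi> :: "real \<Rightarrow> real" and \<rho> :: real
  assumes "twice_cont_diff_on {0..1} \<Phi>"
    and "strictly_convex_on {0..1} \<Phi>"
    and "0 < \<rho>" and "\<rho> < 1"
  shows "\<exists>\<epsilon>>0. \<forall>n\<ge>1. \<forall>f.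
           boolean_fun n f \<and> balanced n f \<and>
           0 < Min (dict_dist_sym n f ` {1..n}) \<and> Min (dict_dist_sym n f ` {1..n}) \<le> \<epsilon> \<longrightarrow>
           (\<forall>f\<^sub>d. dictator n f\<^sub>d \<longrightarrow> Stab \<Phi> \<rho> n f < Stab \<Phi> \<rho> n f\<^sub>d)"
proof -
  have \<rho>: "\<bar>\<rho>\<bar> \<le> 1"
    using assms(3,4) by simp
  obtain \<phi> M where M: "0 < M"
    and d: "\<And>x. x \<in> {0..1} \<Longrightarrow> (\<Phi> has_real_derivative \<phi> x) (at x within {0..1})"
    and taylor: "\<And>t u. t \<in> {0..1} \<Longrightarrow> u \<in> {0..1} \<Longrightarrow>
      \<Phi> u \<le> \<Phi> t + \<phi> t * (u - t) + M * (u - t)\<^sup>2"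
    by (rule quadratic_upper_bound[OF assms(1)]) (rule that)
  define \<kappa> where "\<kappa> = \<rho> * ((\<phi> ((1 + \<rho>) / 2) - \<phi> ((1 - \<rho>) / 2)) / 2)"
  have "\<phi> ((1 - \<rho>) / 2) < \<phi> ((1 + \<rho>) / 2)"
    using assms(3,4) by (intro strictly_convex_deriv_strict_mono[OF assms(2) d]) auto
  then have \<kappa>: "0 < \<kappa>"
    using assms(3) by (simp add: \<kappa>_def)
  \<comment> \<open>The number of squarings that bring \<open>\<rho>\<close> into the range of the hypercontractive inequality.\<close>
  obtain K where K: "\<rho> ^ K < 1 / 3"
    using real_arch_pow_inv[of "1/3" \<rho>] assms(4) by auto
  have "K \<le> 2 ^ K * 2"
    using less_exp[of K] by linarith
  then have "(\<rho> ^ 2 ^ K)\<^sup>2 \<le> \<rho> ^ K"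
    unfolding power_mult[symmetric] using assms(3,4) by (intro power_decreasing) auto
  with K have K': "(\<rho> ^ 2 ^ K)\<^sup>2 \<le> 1 / 3"
    by simp
  \<comment> \<open>Small-set expansion will give \<open>(N / \<delta>) ^ 2 ^ Suc K \<le> \<delta>\<close>, while \<open>N / \<delta> < \<kappa> / M\<close> is what
    makes the loss dominate; halving turns \<open>\<delta> \<le> \<epsilon>\<close> into a strict inequality.\<close>
  define \<epsilon> where "\<epsilon> = (\<kappa> / M) ^ 2 ^ Suc K / 2"
  have \<epsilon>: "0 < \<epsilon>" "\<epsilon> < (\<kappa> / M) ^ 2 ^ Suc K"
    using \<kappa> M by (simp_all add: \<epsilon>_def)
  show ?thesis
  proof (intro exI[of _ \<epsilon>] conjI allI impI \<epsilon>(1); elim conjE)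
    fix n :: nat and f f\<^sub>d
    assume n: "1 \<le> n" and f: "boolean_fun n f" "balanced n f" and fd: "dictator n f\<^sub>d"
      and Min: "0 < Min (dict_dist_sym n f ` {1..n})" "Min (dict_dist_sym n f ` {1..n}) \<le> \<epsilon>"
    have "Min (dict_dist_sym n f ` {1..n}) \<in> dict_dist_sym n f ` {1..n}"
      using n by (intro Min_in) auto
    then obtain k where k: "k \<in> {1..n}" and dk: "0 < dict_dist_sym n f k" "dict_dist_sym n f k \<le> \<epsilon>"
      using Min by auto
    obtain s :: real where s: "s = 1 \<or> s = -1"
      and dist: "dict_dist_sym n f k = cube_mean n (\<lambda>x. (f x - (1/2 + s/2 * of_int (x k)))\<^sup>2)"
      using dict_dist_sym_eq_mean[OF k f(1)] by blast
    define h where "h = (\<lambda>x. f x - (1/2 + s/2 * of_int (x k)))"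
    define \<delta> where "\<delta> = cube_mean n (\<lambda>x. (h x)\<^sup>2)"
    define N where "N = cube_mean n (\<lambda>x. (smooth \<rho> n h x)\<^sup>2)"
    have \<delta>: "0 < \<delta>" "\<delta> \<le> \<epsilon>"
      using dk by (simp_all add: \<delta>_def h_def dist)
    have h_vals: "h x \<in> {-1, 0, 1}" if "x \<in> cube n" for x
      using boolean_fun_cases[OF f(1) that] cube_coord[OF that k] s by (auto simp: h_def)
    have "(N / \<delta>) ^ 2 ^ Suc K \<le> \<delta>"
      unfolding N_def by (rule small_set_expansion[OF K' h_vals \<delta>_def \<delta>(1)])
    with \<delta>(2) \<epsilon>(2) have "(N / \<delta>) ^ 2 ^ Suc K < (\<kappa> / M) ^ 2 ^ Suc K"
      by linarith
    then have "N / \<delta> < \<kappa> / M"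
      by (rule power_less_imp_less_base) (use \<kappa> M in simp)
    then have "M * N < \<kappa> * \<delta>"
      using M \<delta>(1) by (simp add: field_simps)
    moreover have "Stab \<Phi> \<rho> n f \<le> (\<Phi> ((1 + \<rho>) / 2) + \<Phi> ((1 - \<rho>) / 2)) / 2 - \<kappa> * \<delta> + M * N"
      unfolding \<kappa>_def \<delta>_def N_def
      by (rule Stab_near_dictator_le[OF k s \<rho> f h_def taylor])
    ultimately show "Stab \<Phi> \<rho> n f < Stab \<Phi> \<rho> n f\<^sub>d"
      unfolding Stab_dictator[OF \<rho> fd] by linarith
  qed
qed

end
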